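(* Let $X$ be a Hausdorff topological space with no isolated point. Then every $f\in\mathrm{PC}(X)$ has a unique maximal representative, that is, a homeomorphism $\alpha(f):D_f\to D'_f$ with $D_f,D'_f$ cofinite subsets of $X$, representing $f$, that extends all other representatives of $f$. The assignment $f\mapsto\alpha(f)$ is a continuous partial action of $\mathrm{PC}(X)$ on $X$.
   Context: For a topological space $X$, consider homeomorphisms $D\to D'$ between open cofinite subsets of $X$. Identifying two of these whenever they coincide outside a finite subset, one obtains (with law induced by composition of partial maps) a group $\mathrm{PC}(X)$; a homeomorphism between open cofinite subsets in the class $f$ is called a representative of $f$. A continuous partial action of a (discrete) group $G$ on $X$ is a map $\alpha$ from $G$ to the set of partial homeomorphisms of $X$ (homeomorphisms between two open subsets of $X$) such that $\alpha(1)=\mathrm{id}_X$, $\alpha(g^{-1})=\alpha(g)^{-1}$ (the inverse partial homeomorphism) and $\alpha(g)\circ\alpha(h)\subset\alpha(gh)$ for all $g,h\in G$. Here $\alpha(g)\circ\alpha(h)$ has domain the set of $x$ in the domain of $\alpha(h)$ with $\alpha(h)(x)$ in the domain of $\alpha(g)$, and $u\subset v$ means that $v$ extends $u$. *)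

theory Defs
  imports "HOL-Analysis.Analysis" "HOL-Algebra.Group"
begin

text \<open>
  Partial maps of a space are elements of \<^typ>\<open>'a \<rightharpoonup> 'a\<close>, so that a partial map determines its
  domain \<^term>\<open>dom u\<close> and image \<^term>\<open>ran u\<close>. The library composition \<^term>\<open>u \<circ>\<^sub>m v\<close> is defined
  exactly at those points of \<^term>\<open>dom v\<close> that \<^term>\<open>v\<close> sends into \<^term>\<open>dom u\<close>, and
  \<^term>\<open>u \<subseteq>\<^sub>m v\<close> says that \<^term>\<open>v\<close> extends \<^term>\<open>u\<close>.
\<close>

definition partial_homeo :: "'a topology \<Rightarrow> ('a \<rightharpoonup> 'a) \<Rightarrow> bool" where
  "partial_homeo X u \<longleftrightarrow>
     openin X (dom u) \<and> openin X (ran u) \<and>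
     homeomorphic_map (subtopology X (dom u)) (subtopology X (ran u)) (the \<circ> u)"

definition partial_id :: "'a topology \<Rightarrow> ('a \<rightharpoonup> 'a)" where
  "partial_id X = Some |` topspace X"

text \<open>Meaningful for injective partial maps only.\<close>
definition partial_inv :: "('a \<rightharpoonup> 'a) \<Rightarrow> ('a \<rightharpoonup> 'a)" where
  "partial_inv u = (\<lambda>y. if y \<in> ran u then Some (THE x. u x = Some y) else None)"

definition cofinite_homeos :: "'a topology \<Rightarrow> ('a \<rightharpoonup> 'a) set" where
  "cofinite_homeos X =
     {u. partial_homeo X u \<and> finite (topspace X - dom u) \<and> finite (topspace X - ran u)}"

text \<open>
  The inequality below is one of option values, so it includes the points where just one of the two
  maps is defined; as both domains are cofinite, this does not affect finiteness.
\<close>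
definition eq_mod_finite :: "'a topology \<Rightarrow> (('a \<rightharpoonup> 'a) \<times> ('a \<rightharpoonup> 'a)) set" where
  "eq_mod_finite X =
     {(u, v). u \<in> cofinite_homeos X \<and> v \<in> cofinite_homeos X \<and>
        finite {x \<in> topspace X. u x \<noteq> v x}}"

text \<open>
  An element of the group is an equivalence class, that is, the set of its representatives.
\<close>
definition PC :: "'a topology \<Rightarrow> ('a \<rightharpoonup> 'a) set monoid" where
  "PC X = \<lparr>carrier = cofinite_homeos X // eq_mod_finite X,
           mult = (\<lambda>f g. \<Union>u\<in>f. \<Union>v\<in>g. eq_mod_finite X `` {u \<circ>\<^sub>m v}),
           one = eq_mod_finite X `` {partial_id X}\<rparr>"

definition is_maximal_representative :: "('a \<rightharpoonup> 'a) set \<Rightarrow> ('a \<rightharpoonup> 'a) \<Rightarrow> bool" where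
  "is_maximal_representative f u \<longleftrightarrow> u \<in> f \<and> (\<forall>v\<in>f. v \<subseteq>\<^sub>m u)"

definition maximal_representative :: "('a \<rightharpoonup> 'a) set \<Rightarrow> ('a \<rightharpoonup> 'a)" where
  "maximal_representative f = (THE u. is_maximal_representative f u)"

locale continuous_partial_action = group G for G (structure) +
  fixes X :: "'a topology" and \<alpha> :: "'g \<Rightarrow> ('a \<rightharpoonup> 'a)"
  assumes partial_homeo: "g \<in> carrier G \<Longrightarrow> partial_homeo X (\<alpha> g)"
    and one: "\<alpha> \<one> = partial_id X"
    and inverse: "g \<in> carrier G \<Longrightarrow> \<alpha> (inv g) = partial_inv (\<alpha> g)"
    and mult: "g \<in> carrier G \<Longrightarrow> h \<in> carrier G \<Longrightarrow> \<alpha> g \<circ>\<^sub>m \<alpha> h \<subseteq>\<^sub>m \<alpha> (g \<otimes> h)"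

end

theory Submission
  imports Defs
begin

text \<open>
  Two representatives of the same class agree on the whole intersection of their domains: near a
  point where they differ they would differ on a nonempty open set, which is infinite. Hence the
  representatives of a class glue to a partial map. The inverses of the representatives also form a
  class, so they glue as well, and the glued maps are inverse to each other.
\<close>

section \<open>Partial continuous maps and inverses of injective partial maps\<close>

text \<open>Continuity on an open domain, phrased with open sets of \<open>X\<close> itself rather
  than of subtopologies. In this form composition, inversion and gluing become manipulations of
  preimage sets.\<close>

definition partial_continuous :: "'a topology \<Rightarrow> ('a \<rightharpoonup> 'a) \<Rightarrow> bool" where
  "partial_continuous X u \<longleftrightarrow> dom u \<subseteq> topspace X \<and> ran u \<subseteq> topspace X \<and>
     (\<forall>V. openin X V \<longrightarrow> openin X {x. \<exists>y\<in>V. u x = Some y})"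

lemma partial_continuousD:
  assumes "partial_continuous X u"
  shows "dom u \<subseteq> topspace X" "ran u \<subseteq> topspace X"
    "openin X V \<Longrightarrow> openin X {x. \<exists>y\<in>V. u x = Some y}"
  using assms by (auto simp: partial_continuous_def)

lemma partial_continuous_openin_dom:
  assumes "partial_continuous X u"
  shows "openin X (dom u)"
proof -
  \<comment> \<open>Openness of the domain is the preimage condition for the whole space, since all
    values lie in \<open>topspace X\<close>.\<close>
  have "dom u = {x. \<exists>y\<in>topspace X. u x = Some y}"
    using partial_continuousD(2)[OF assms] by (auto simp: ran_def)
  then show ?thesis using partial_continuousD(3)[OF assms openin_topspace] by simp
qed

lemma inj_on_domD: "inj_on u (dom u) \<Longrightarrow> u a = Some y \<Longrightarrow> u b = Some y \<Longrightarrow> a = b"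
  by (metis domI inj_onD)

text \<open>Injectivity makes the \<open>THE\<close> in \<open>partial_inv\<close> well defined.
  From here on the inverse is handled as the converse graph, and facts about it reduce to
  \<open>map_eqI\<close>.\<close>

lemma partial_inv_eq_Some_iff:
  assumes "inj_on u (dom u)"
  shows "partial_inv u y = Some x \<longleftrightarrow> u x = Some y"
proof -
  note eq = inj_on_domD[OF assms]
  have "(THE z. u z = Some y) = a" if "u a = Some y" for a
    using that eq by blast
  then show ?thesis using eq by (auto simp: partial_inv_def ran_def)
qed

lemma dom_partial_inv: "dom (partial_inv u) = ran u"
  by (auto simp: partial_inv_def split: if_splits)

lemma ran_partial_inv: "inj_on u (dom u) \<Longrightarrow> ran (partial_inv u) = dom u"
  by (auto simp: ran_def partial_inv_eq_Some_iff)

lemma inj_on_partial_inv: "inj_on u (dom u) \<Longrightarrow> inj_on (partial_inv u) (dom (partial_inv u))"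
  by (rule inj_onI) (metis domD option.inject partial_inv_eq_Some_iff)

lemma map_eqI: "(\<And>x y. u x = Some y \<longleftrightarrow> v x = Some y) \<Longrightarrow> u = v"
  by (metis option.exhaust ext)

lemma partial_inv_partial_inv: "inj_on u (dom u) \<Longrightarrow> partial_inv (partial_inv u) = u"
  by (rule map_eqI) (simp add: partial_inv_eq_Some_iff inj_on_partial_inv)

lemma inj_on_map_comp:
  "inj_on u (dom u) \<Longrightarrow> inj_on v (dom v) \<Longrightarrow> inj_on (u \<circ>\<^sub>m v) (dom (u \<circ>\<^sub>m v))"
  unfolding inj_on_def dom_def by (force simp: map_comp_Some_iff)

lemma partial_inv_map_comp:
  assumes "inj_on u (dom u)" "inj_on v (dom v)"
  shows "partial_inv (u \<circ>\<^sub>m v) = partial_inv v \<circ>\<^sub>m partial_inv u"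
  by (rule map_eqI)
    (auto simp: partial_inv_eq_Some_iff assms inj_on_map_comp map_comp_Some_iff)

text \<open>A form symmetric in \<open>u\<close> and its inverse: being open for \<open>u\<close> is
  the same as being continuous for \<open>partial_inv u\<close>. The two open sets of the definition
  reappear as the domains of \<open>u\<close> and of \<open>partial_inv u\<close>.\<close>

lemma partial_homeo_iff:
  "partial_homeo X u \<longleftrightarrow>
     inj_on u (dom u) \<and> partial_continuous X u \<and> partial_continuous X (partial_inv u)"
proof
  assume u: "partial_homeo X u"
  let ?D = "subtopology X (dom u)" and ?R = "subtopology X (ran u)"
  have o: "openin X (dom u)" "openin X (ran u)"
    and h: "homeomorphic_map ?D ?R (the \<circ> u)"
    using u by (auto simp: partial_homeo_def)
  have s: "dom u \<subseteq> topspace X" "ran u \<subseteq> topspace X"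
    using o by (auto dest: openin_subset)
  have "inj_on (the \<circ> u) (dom u)"
    using homeomorphic_imp_injective_map[OF h] s by (simp add: inf.absorb2)
  then have inj: "inj_on u (dom u)" by (rule inj_on_imageI2)
  have pre: "openin X {x. \<exists>y\<in>V. u x = Some y}" if V: "openin X V" for V
  proof -
    have "openin ?R (ran u \<inter> V)" using V by (auto simp: openin_subtopology)
    then have "openin ?D {x \<in> topspace ?D. (the \<circ> u) x \<in> ran u \<inter> V}"
      using homeomorphic_imp_continuous_map[OF h] openin_continuous_map_preimage by blast
    \<comment> \<open>Open subsets of the open subspace \<open>?D\<close> are open in
      \<open>X\<close>.\<close>
    then have "openin X {x \<in> topspace ?D. (the \<circ> u) x \<in> ran u \<inter> V}"
      using o(1) openin_trans_full by blast
    also have "{x \<in> topspace ?D. (the \<circ> u) x \<in> ran u \<inter> V} = {x. \<exists>y\<in>V. u x = Some y}"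
      using s by (auto simp: ran_def)
    finally show ?thesis .
  qed
  \<comment> \<open>The image of \<open>V\<close> under \<open>u\<close> is the preimage of
    \<open>V\<close> under the inverse, so openness of \<open>u\<close> yields the remaining
    continuity statement.\<close>
  have im: "openin X {y. \<exists>x\<in>V. u x = Some y}" if V: "openin X V" for V
  proof -
    have "openin ?D (dom u \<inter> V)" using V by (auto simp: openin_subtopology)
    then have "openin ?R ((the \<circ> u) ` (dom u \<inter> V))"
      using homeomorphic_imp_open_map[OF h] by (simp add: open_map_def)
    then have "openin X ((the \<circ> u) ` (dom u \<inter> V))"
      using o(2) openin_trans_full by blast
    also have "(the \<circ> u) ` (dom u \<inter> V) = {y. \<exists>x\<in>V. u x = Some y}"
      by force
    finally show ?thesis .
  qed
  show "inj_on u (dom u) \<and> partial_continuous X u \<and> partial_continuous X (partial_inv u)"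
    using inj s pre im
    by (simp add: partial_continuous_def dom_partial_inv ran_partial_inv partial_inv_eq_Some_iff)
next
  assume "inj_on u (dom u) \<and> partial_continuous X u \<and> partial_continuous X (partial_inv u)"
  then have inj: "inj_on u (dom u)" and c: "partial_continuous X u"
    and c': "partial_continuous X (partial_inv u)" by auto
  let ?D = "subtopology X (dom u)" and ?R = "subtopology X (ran u)"
  note s = partial_continuousD(1,2)[OF c]
  have o: "openin X (dom u)" "openin X (ran u)"
    using partial_continuous_openin_dom[OF c] partial_continuous_openin_dom[OF c']
    by (simp_all add: dom_partial_inv)
  have "homeomorphic_map ?D ?R (the \<circ> u)"
  proof (rule bijective_open_imp_homeomorphic_map)
    show "continuous_map ?D ?R (the \<circ> u)"
    proof (subst continuous_map_in_subtopology, intro conjI)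
      show "(the \<circ> u) \<in> topspace ?D \<rightarrow> ran u" by (auto intro: ranI)
      show "continuous_map ?D X (the \<circ> u)"
        unfolding continuous_map
      proof (intro conjI allI impI)
        show "(the \<circ> u) ` topspace ?D \<subseteq> topspace X" using s by (auto intro: ranI)
        fix V assume V: "openin X V"
        have "{x \<in> topspace ?D. (the \<circ> u) x \<in> V} = {x. \<exists>y\<in>V. u x = Some y} \<inter> dom u"
          using s by auto
        then show "openin ?D {x \<in> topspace ?D. (the \<circ> u) x \<in> V}"
          using partial_continuousD(3)[OF c V] unfolding openin_subtopology by blast
      qed
    qed
    show "open_map ?D ?R (the \<circ> u)"
      unfolding open_map_def
    proof (intro allI impI)
      fix U assume U: "openin ?D U"
      then have "openin X U" using o(1) openin_trans_full by blast
      \<comment> \<open>Conversely, the image of \<open>U\<close> is read as a preimage under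
        \<open>partial_inv u\<close>, whose continuity is assumed.\<close>
      then have "openin X {y. \<exists>x\<in>U. u x = Some y}"
        using partial_continuousD(3)[OF c'] by (simp add: partial_inv_eq_Some_iff inj)
      moreover have "(the \<circ> u) ` U = {y. \<exists>x\<in>U. u x = Some y} \<inter> ran u"
        using openin_subset[OF U] by (force simp: ran_def)
      ultimately show "openin ?R ((the \<circ> u) ` U)" unfolding openin_subtopology by blast
    qed
    show "(the \<circ> u) ` topspace ?D = topspace ?R"
      using s by (force simp: ran_def)
    show "inj_on (the \<circ> u) (topspace ?D)"
      by (rule inj_onI) (auto dest: inj_on_domD[OF inj])
  qed
  then show "partial_homeo X u" using o by (simp add: partial_homeo_def)
qed

lemma partial_continuous_map_comp:
  assumes u: "partial_continuous X u" and v: "partial_continuous X v"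
  shows "partial_continuous X (u \<circ>\<^sub>m v)"
  unfolding partial_continuous_def
proof (intro conjI allI impI)
  show "dom (u \<circ>\<^sub>m v) \<subseteq> topspace X"
    using partial_continuousD(1)[OF v] by (force simp: map_comp_Some_iff)
  show "ran (u \<circ>\<^sub>m v) \<subseteq> topspace X"
    using partial_continuousD(2)[OF u] by (auto simp: ran_def map_comp_Some_iff)
  fix V assume "openin X V"
  then have "openin X {x. \<exists>z\<in>{z. \<exists>y\<in>V. u z = Some y}. v x = Some z}"
    by (intro partial_continuousD(3) u v)
  also have "{x. \<exists>z\<in>{z. \<exists>y\<in>V. u z = Some y}. v x = Some z} =
      {x. \<exists>y\<in>V. (u \<circ>\<^sub>m v) x = Some y}"
    by (auto simp: map_comp_Some_iff)
  finally show "openin X {x. \<exists>y\<in>V. (u \<circ>\<^sub>m v) x = Some y}" .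
qed

text \<open>The gluing principle: the graph of \<open>w\<close> is the union of the graphs of the
  members of \<open>F\<close>, so preimages under \<open>w\<close> are unions of preimages. That the
  members agree on overlaps is implicit in the first assumption, because \<open>w\<close> is
  single-valued.\<close>

lemma partial_continuous_Union:
  assumes w: "\<And>x y. w x = Some y \<longleftrightarrow> (\<exists>u\<in>F. u x = Some y)"
    and F: "\<And>u. u \<in> F \<Longrightarrow> partial_continuous X u"
  shows "partial_continuous X w"
  unfolding partial_continuous_def
proof (intro conjI allI impI)
  show "dom w \<subseteq> topspace X" "ran w \<subseteq> topspace X"
    using F by (auto simp: w ran_def partial_continuous_def) blast+
  fix V assume "openin X V"
  then have "openin X (\<Union>u\<in>F. {x. \<exists>y\<in>V. u x = Some y})"
    using F by (intro openin_Union) (auto simp: partial_continuous_def)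
  also have "(\<Union>u\<in>F. {x. \<exists>y\<in>V. u x = Some y}) = {x. \<exists>y\<in>V. w x = Some y}"
    by (auto simp: w)
  finally show "openin X {x. \<exists>y\<in>V. w x = Some y}" .
qed

lemma partial_id_eq_Some_iff: "partial_id X x = Some y \<longleftrightarrow> x = y \<and> x \<in> topspace X"
  by (auto simp: partial_id_def restrict_map_def)

lemma dom_partial_id: "dom (partial_id X) = topspace X"
  by (auto simp: partial_id_eq_Some_iff)

lemma inj_on_partial_id: "inj_on (partial_id X) (topspace X)"
  by (auto simp: inj_on_def partial_id_def)

lemma partial_inv_partial_id: "partial_inv (partial_id X) = partial_id X"
  by (rule map_eqI)
    (auto simp: partial_inv_eq_Some_iff inj_on_partial_id dom_partial_id partial_id_eq_Some_iff)

lemma partial_continuous_partial_id: "partial_continuous X (partial_id X)"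
  unfolding partial_continuous_def
proof (intro conjI allI impI)
  show "dom (partial_id X) \<subseteq> topspace X" "ran (partial_id X) \<subseteq> topspace X"
    by (auto simp: ran_def partial_id_eq_Some_iff)
  fix V assume V: "openin X V"
  then have "{x. \<exists>y\<in>V. partial_id X x = Some y} = V"
    by (auto simp: partial_id_eq_Some_iff dest: openin_subset)
  then show "openin X {x. \<exists>y\<in>V. partial_id X x = Some y}" using V by simp
qed

section \<open>Homeomorphisms between cofinite open sets: identity, inverse, composition\<close>

lemma cofinite_homeosD:
  assumes "u \<in> cofinite_homeos X"
  shows "inj_on u (dom u)" "partial_continuous X u" "partial_continuous X (partial_inv u)"
    "dom u \<subseteq> topspace X" "ran u \<subseteq> topspace X"
    "finite (topspace X - dom u)" "finite (topspace X - ran u)"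
  using assms by (auto simp: cofinite_homeos_def partial_homeo_iff dest: partial_continuousD)

lemma partial_id_in_cofinite_homeos: "partial_id X \<in> cofinite_homeos X"
proof -
  have "ran (partial_id X) = topspace X"
    by (metis dom_partial_id dom_partial_inv partial_inv_partial_id)
  then show ?thesis
    by (simp add: cofinite_homeos_def partial_homeo_iff inj_on_partial_id
        partial_continuous_partial_id partial_inv_partial_id dom_partial_id)
qed

lemma partial_inv_in_cofinite_homeos:
  "u \<in> cofinite_homeos X \<Longrightarrow> partial_inv u \<in> cofinite_homeos X"
  using inj_on_partial_inv[of u]
  by (simp add: cofinite_homeos_def partial_homeo_iff partial_inv_partial_inv
      dom_partial_inv ran_partial_inv)

text \<open>Each fibre of an injective partial map has at most one point. This is what keeps
  exceptional sets finite under composition.\<close>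

lemma finite_partial_vimage:
  assumes "inj_on v (dom v)" "finite A"
  shows "finite {x. \<exists>y\<in>A. v x = Some y}"
proof -
  have "{x. \<exists>y\<in>A. v x = Some y} = v -` Some ` A \<inter> dom v" by auto
  then show ?thesis using assms by (simp add: finite_vimage_IntI)
qed

text \<open>The composite is undefined at a point of \<open>T\<close> only if \<open>v\<close> is
  undefined there or sends it into the finite set \<open>T - dom u\<close>.\<close>

lemma finite_compl_dom_map_comp:
  assumes "inj_on v (dom v)" "ran v \<subseteq> T" "finite (T - dom u)" "finite (T - dom v)"
  shows "finite (T - dom (u \<circ>\<^sub>m v))"
proof (rule finite_subset)
  show "T - dom (u \<circ>\<^sub>m v) \<subseteq> (T - dom v) \<union> {x. \<exists>y\<in>T - dom u. v x = Some y}"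
    using assms(2) by (fastforce simp: map_comp_def dom_def ran_def split: option.splits)
  show "finite ((T - dom v) \<union> {x. \<exists>y\<in>T - dom u. v x = Some y})"
    using assms by (intro finite_UnI finite_partial_vimage) auto
qed

lemma map_comp_in_cofinite_homeos:
  assumes u: "u \<in> cofinite_homeos X" and v: "v \<in> cofinite_homeos X"
  shows "u \<circ>\<^sub>m v \<in> cofinite_homeos X"
proof -
  note U = cofinite_homeosD[OF u] and V = cofinite_homeosD[OF v]
  note U' = cofinite_homeosD[OF partial_inv_in_cofinite_homeos[OF u]]
    and V' = cofinite_homeosD[OF partial_inv_in_cofinite_homeos[OF v]]
  have "finite (topspace X - dom (u \<circ>\<^sub>m v))"
    using U V by (intro finite_compl_dom_map_comp)
  \<comment> \<open>The image of the composite is the domain of its inverse, so the count for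
    domains is applied once more, to the inverses in reverse order.\<close>
  moreover have "finite (topspace X - dom (partial_inv v \<circ>\<^sub>m partial_inv u))"
    using U' V' by (intro finite_compl_dom_map_comp)
  then have "finite (topspace X - ran (u \<circ>\<^sub>m v))"
    by (metis U(1) V(1) partial_inv_map_comp dom_partial_inv)
  ultimately show ?thesis
    using U V
    by (simp add: cofinite_homeos_def partial_homeo_iff inj_on_map_comp partial_inv_map_comp
        partial_continuous_map_comp)
qed

section \<open>Equality up to finite sets as a congruence\<close>

lemma equiv_eq_mod_finite: "equiv (cofinite_homeos X) (eq_mod_finite X)"
proof (rule equivI)
  show "eq_mod_finite X \<subseteq> cofinite_homeos X \<times> cofinite_homeos X"
    by (auto simp: eq_mod_finite_def)
  show "refl_on (cofinite_homeos X) (eq_mod_finite X)"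
    by (auto simp: refl_on_def eq_mod_finite_def)
  show "sym (eq_mod_finite X)"
    by (auto simp: sym_def eq_mod_finite_def eq_commute)
  show "trans (eq_mod_finite X)"
  proof (rule transI)
    fix u v w assume "(u, v) \<in> eq_mod_finite X" "(v, w) \<in> eq_mod_finite X"
    moreover from this have "finite {x \<in> topspace X. u x \<noteq> w x}"
      by (intro finite_subset[of "{x \<in> topspace X. u x \<noteq> w x}"
            "{x \<in> topspace X. u x \<noteq> v x} \<union> {x \<in> topspace X. v x \<noteq> w x}"])
        (auto simp: eq_mod_finite_def)
    ultimately show "(u, w) \<in> eq_mod_finite X" by (simp add: eq_mod_finite_def)
  qed
qed

text \<open>Where the composites differ, either \<open>v\<close> and \<open>v'\<close> differ, or
  they share a value at which \<open>u\<close> and \<open>u'\<close> differ. The second case is a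
  preimage of a finite set under the injective map \<open>v\<close>.\<close>

lemma eq_mod_finite_map_comp:
  assumes "(u, u') \<in> eq_mod_finite X" "(v, v') \<in> eq_mod_finite X"
  shows "(u \<circ>\<^sub>m v, u' \<circ>\<^sub>m v') \<in> eq_mod_finite X"
proof -
  let ?A = "{x \<in> topspace X. u x \<noteq> u' x}" and ?B = "{x \<in> topspace X. v x \<noteq> v' x}"
  have c: "u \<in> cofinite_homeos X" "u' \<in> cofinite_homeos X"
    "v \<in> cofinite_homeos X" "v' \<in> cofinite_homeos X"
    and f: "finite ?A" "finite ?B"
    using assms by (auto simp: eq_mod_finite_def)
  have "{x \<in> topspace X. (u \<circ>\<^sub>m v) x \<noteq> (u' \<circ>\<^sub>m v') x} \<subseteq> ?B \<union> {x. \<exists>y\<in>?A. v x = Some y}"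
    using cofinite_homeosD(5)[OF c(3)]
    by (fastforce simp: map_comp_def ran_def split: option.splits)
  moreover have "finite (?B \<union> {x. \<exists>y\<in>?A. v x = Some y})"
    using f cofinite_homeosD(1)[OF c(3)] by (intro finite_UnI finite_partial_vimage)
  ultimately have "finite {x \<in> topspace X. (u \<circ>\<^sub>m v) x \<noteq> (u' \<circ>\<^sub>m v') x}"
    by (rule finite_subset)
  then show ?thesis using c by (simp add: eq_mod_finite_def map_comp_in_cofinite_homeos)
qed

text \<open>If the inverses differ at \<open>y\<close>, then either \<open>y\<close> misses the
  image of \<open>u\<close>, or \<open>y\<close> is the value of \<open>u\<close> at a point where
  \<open>u\<close> and \<open>v\<close> differ; both kinds of points are finite in number.\<close>

lemma eq_mod_finite_partial_inv:
  assumes "(u, v) \<in> eq_mod_finite X"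
  shows "(partial_inv u, partial_inv v) \<in> eq_mod_finite X"
proof -
  let ?A = "{x \<in> topspace X. u x \<noteq> v x}"
  have c: "u \<in> cofinite_homeos X" "v \<in> cofinite_homeos X" and f: "finite ?A"
    using assms by (auto simp: eq_mod_finite_def)
  note U = cofinite_homeosD[OF c(1)] and V = cofinite_homeosD[OF c(2)]
  have "y \<in> (topspace X - ran u) \<union> (the \<circ> u) ` ?A"
    if y: "y \<in> topspace X" "partial_inv u y \<noteq> partial_inv v y" for y
  proof (cases "y \<in> ran u")
    case True
    then obtain x where x: "u x = Some y" by (auto simp: ran_def)
    then have "v x \<noteq> Some y"
      using y(2) partial_inv_eq_Some_iff[OF U(1)] partial_inv_eq_Some_iff[OF V(1)] by metis
    then have "x \<in> ?A" using x U(4) by auto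
    then show ?thesis using x by force
  qed (use y in simp)
  then have "{y \<in> topspace X. partial_inv u y \<noteq> partial_inv v y} \<subseteq>
      (topspace X - ran u) \<union> (the \<circ> u) ` ?A" by blast
  moreover have "finite ((topspace X - ran u) \<union> (the \<circ> u) ` ?A)"
    using U(7) f by simp
  ultimately have "finite {y \<in> topspace X. partial_inv u y \<noteq> partial_inv v y}"
    by (rule finite_subset)
  then show ?thesis using c by (simp add: eq_mod_finite_def partial_inv_in_cofinite_homeos)
qed

section \<open>The group \<open>PC X\<close>\<close>

lemma carrier_PC: "carrier (PC X) = cofinite_homeos X // eq_mod_finite X"
  and one_PC: "\<one>\<^bsub>PC X\<^esub> = eq_mod_finite X `` {partial_id X}"
  by (simp_all add: PC_def)

lemma carrier_PC_E:
  assumes "f \<in> carrier (PC X)"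
  obtains u where "u \<in> cofinite_homeos X" "f = eq_mod_finite X `` {u}"
  using assms by (auto simp: carrier_PC elim: quotientE)

lemma class_in_carrier_PC:
  "u \<in> cofinite_homeos X \<Longrightarrow> eq_mod_finite X `` {u} \<in> carrier (PC X)"
  by (auto simp: carrier_PC quotientI)

text \<open>Since composition respects the relation, the double union defining the product is a
  union of copies of one and the same class.\<close>

lemma mult_PC_class:
  assumes "u \<in> cofinite_homeos X" "v \<in> cofinite_homeos X"
  shows "eq_mod_finite X `` {u} \<otimes>\<^bsub>PC X\<^esub> eq_mod_finite X `` {v} = eq_mod_finite X `` {u \<circ>\<^sub>m v}"
proof -
  have "(\<lambda>u v. eq_mod_finite X `` {u \<circ>\<^sub>m v}) respects2 eq_mod_finite X"
    by (auto intro!: congruent2I' equiv_class_eq[OF equiv_eq_mod_finite] eq_mod_finite_map_comp)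
  then show ?thesis
    using UN_equiv_class2[OF equiv_eq_mod_finite equiv_eq_mod_finite] assms by (simp add: PC_def)
qed

lemma mem_class: "u \<in> cofinite_homeos X \<Longrightarrow> u \<in> eq_mod_finite X `` {u}"
  by (rule equiv_class_self[OF equiv_eq_mod_finite])

lemma class_eqI:
  assumes "u \<in> cofinite_homeos X" "v \<in> cofinite_homeos X" "finite {x \<in> topspace X. u x \<noteq> v x}"
  shows "eq_mod_finite X `` {u} = eq_mod_finite X `` {v}"
  using assms by (intro equiv_class_eq[OF equiv_eq_mod_finite]) (simp add: eq_mod_finite_def)

lemma inverse_mult_PC_class:
  assumes u: "u \<in> cofinite_homeos X"
  shows "eq_mod_finite X `` {partial_inv u} \<otimes>\<^bsub>PC X\<^esub> eq_mod_finite X `` {u} = \<one>\<^bsub>PC X\<^esub>"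
proof -
  note U = cofinite_homeosD[OF u] and i = partial_inv_in_cofinite_homeos[OF u]
  \<comment> \<open>The composite is the identity on \<open>dom u\<close> only, which suffices
    because the complement of \<open>dom u\<close> is finite.\<close>
  have "(partial_inv u \<circ>\<^sub>m u) x = partial_id X x" if "x \<in> dom u" for x
  proof -
    obtain y where y: "u x = Some y" using \<open>x \<in> dom u\<close> by auto
    then have "partial_inv u y = Some x" using U(1) by (simp add: partial_inv_eq_Some_iff)
    then show ?thesis using y U(4) that by (auto simp: partial_id_def)
  qed
  then have "finite {x \<in> topspace X. (partial_inv u \<circ>\<^sub>m u) x \<noteq> partial_id X x}"
    by (intro finite_subset[OF _ U(6)]) blast
  then have "eq_mod_finite X `` {partial_inv u \<circ>\<^sub>m u} = eq_mod_finite X `` {partial_id X}"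
    using u i by (intro class_eqI map_comp_in_cofinite_homeos partial_id_in_cofinite_homeos)
  then show ?thesis by (simp add: mult_PC_class u i one_PC)
qed

lemma group_PC: "group (PC X)"
proof (rule groupI)
  show "\<one>\<^bsub>PC X\<^esub> \<in> carrier (PC X)"
    by (simp add: one_PC class_in_carrier_PC partial_id_in_cofinite_homeos)
next
  fix f g assume "f \<in> carrier (PC X)" "g \<in> carrier (PC X)"
  then show "f \<otimes>\<^bsub>PC X\<^esub> g \<in> carrier (PC X)"
    by (auto elim!: carrier_PC_E
        simp: mult_PC_class class_in_carrier_PC map_comp_in_cofinite_homeos)
next
  fix f g h assume "f \<in> carrier (PC X)" "g \<in> carrier (PC X)" "h \<in> carrier (PC X)"
  \<comment> \<open>Associativity holds exactly for partial maps, before passing to classes; so does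
    the left unit law below, as \<open>u\<close> takes its values in
    \<open>topspace X\<close>.\<close>
  moreover have "(u \<circ>\<^sub>m v) \<circ>\<^sub>m w = u \<circ>\<^sub>m (v \<circ>\<^sub>m w)" for u v w :: "'a \<rightharpoonup> 'a"
    by (rule map_eqI) (auto simp: map_comp_Some_iff)
  ultimately show "f \<otimes>\<^bsub>PC X\<^esub> g \<otimes>\<^bsub>PC X\<^esub> h = f \<otimes>\<^bsub>PC X\<^esub> (g \<otimes>\<^bsub>PC X\<^esub> h)"
    by (auto elim!: carrier_PC_E simp: mult_PC_class map_comp_in_cofinite_homeos)
next
  fix f assume "f \<in> carrier (PC X)"
  then obtain u where u: "u \<in> cofinite_homeos X" "f = eq_mod_finite X `` {u}"
    by (rule carrier_PC_E)
  have "partial_id X \<circ>\<^sub>m u = u"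
    using cofinite_homeosD(5)[OF u(1)]
    by (intro map_eqI) (auto simp: map_comp_Some_iff partial_id_eq_Some_iff ran_def)
  then show "\<one>\<^bsub>PC X\<^esub> \<otimes>\<^bsub>PC X\<^esub> f = f"
    by (simp add: one_PC u mult_PC_class partial_id_in_cofinite_homeos)
  show "\<exists>g\<in>carrier (PC X). g \<otimes>\<^bsub>PC X\<^esub> f = \<one>\<^bsub>PC X\<^esub>"
    using u inverse_mult_PC_class class_in_carrier_PC partial_inv_in_cofinite_homeos by blast
qed

lemma inv_PC_class:
  assumes "u \<in> cofinite_homeos X"
  shows "inv\<^bsub>PC X\<^esub> (eq_mod_finite X `` {u}) = eq_mod_finite X `` {partial_inv u}"
  using assms
  by (intro group.inv_equality[OF group_PC] inverse_mult_PC_class class_in_carrier_PC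
      partial_inv_in_cofinite_homeos)

text \<open>Any member of a class may serve as the one that generates it, which reduces statements
  about arbitrary representatives to the class formulas above.\<close>

lemma carrier_PC_eq_class:
  "f \<in> carrier (PC X) \<Longrightarrow> u \<in> f \<Longrightarrow> u \<in> cofinite_homeos X \<and> f = eq_mod_finite X `` {u}"
  by (auto elim!: carrier_PC_E dest: equiv_class_eq[OF equiv_eq_mod_finite])
    (simp_all add: eq_mod_finite_def)

lemma map_comp_in_mult_PC:
  assumes "f \<in> carrier (PC X)" "g \<in> carrier (PC X)" "u \<in> f" "v \<in> g"
  shows "u \<circ>\<^sub>m v \<in> f \<otimes>\<^bsub>PC X\<^esub> g"
proof -
  note u = carrier_PC_eq_class[OF assms(1,3)] and v = carrier_PC_eq_class[OF assms(2,4)]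
  have "f \<otimes>\<^bsub>PC X\<^esub> g = eq_mod_finite X `` {u \<circ>\<^sub>m v}"
    using u v by (metis mult_PC_class)
  then show ?thesis
    using u v mem_class[OF map_comp_in_cofinite_homeos] by metis
qed

lemma partial_inv_in_inv_PC:
  assumes "f \<in> carrier (PC X)" "u \<in> f"
  shows "partial_inv u \<in> inv\<^bsub>PC X\<^esub> f"
proof -
  note u = carrier_PC_eq_class[OF assms]
  have "inv\<^bsub>PC X\<^esub> f = eq_mod_finite X `` {partial_inv u}"
    using u by (metis inv_PC_class)
  then show ?thesis
    using u mem_class[OF partial_inv_in_cofinite_homeos] by metis
qed

lemma carrier_PC_eq_mod_finite:
  assumes "f \<in> carrier (PC X)" "u \<in> f" "v \<in> f"
  shows "(u, v) \<in> eq_mod_finite X"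
  using carrier_PC_eq_class[OF assms(1,2)] assms(3) by blast

section \<open>Agreement and gluing of representatives\<close>

text \<open>Finite sets are closed in a Hausdorff space, so removing all points but \<open>x\<close>
  from a finite open \<open>N\<close> would leave \<open>{x}\<close> open.\<close>

lemma infinite_openin_no_isolated:
  assumes "Hausdorff_space X" "\<And>x. x \<in> topspace X \<Longrightarrow> \<not> openin X {x}"
    and "openin X N" "x \<in> N"
  shows "infinite N"
proof
  assume "finite N"
  then have "closedin X (N - {x})"
    using assms openin_subset[OF assms(3)]
    by (intro closedin_Hausdorff_finite) auto
  then have "openin X (N - (N - {x}))" using assms(3) by (rule openin_diff[rotated])
  moreover have "N - (N - {x}) = {x}" using assms(4) by auto
  ultimately show False using assms(2,4) openin_subset[OF assms(3)] by auto
qed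

lemma eq_mod_finite_agree:
  assumes X: "Hausdorff_space X" "\<And>x. x \<in> topspace X \<Longrightarrow> \<not> openin X {x}"
    and uv: "(u, v) \<in> eq_mod_finite X"
    and x: "u x = Some y" "v x = Some z"
  shows "y = z"
proof (rule ccontr)
  assume "y \<noteq> z"
  have c: "u \<in> cofinite_homeos X" "v \<in> cofinite_homeos X"
    and f: "finite {x \<in> topspace X. u x \<noteq> v x}"
    using uv by (auto simp: eq_mod_finite_def)
  note U = cofinite_homeosD[OF c(1)] and V = cofinite_homeosD[OF c(2)]
  have "y \<in> topspace X" "z \<in> topspace X" using x U(5) V(5) by (auto simp: ran_def)
  then obtain A B where AB: "openin X A" "openin X B" "y \<in> A" "z \<in> B" "disjnt A B"
    using X(1) \<open>y \<noteq> z\<close> unfolding Hausdorff_space_def by metis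
  \<comment> \<open>Disjointness of \<open>A\<close> and \<open>B\<close> makes \<open>u\<close> and
    \<open>v\<close> differ throughout \<open>N\<close>, so a single point of disagreement spreads
    to an open set.\<close>
  define N where "N = {x. \<exists>y\<in>A. u x = Some y} \<inter> {x. \<exists>y\<in>B. v x = Some y}"
  have "openin X N"
    unfolding N_def using AB by (intro openin_Int partial_continuousD(3) U(2) V(2))
  moreover have "x \<in> N" using x AB by (auto simp: N_def)
  ultimately have "infinite N" using infinite_openin_no_isolated X by metis
  moreover have "N \<subseteq> {x \<in> topspace X. u x \<noteq> v x}"
    using AB(5) U(4) by (auto simp: N_def disjnt_iff)
  ultimately show False using f finite_subset by blast
qed

lemma ex_maximal_representative:
  assumes X: "Hausdorff_space X" "\<And>x. x \<in> topspace X \<Longrightarrow> \<not> openin X {x}"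
    and f: "f \<in> carrier (PC X)"
  shows "\<exists>w. is_maximal_representative f w"
proof -
  \<comment> \<open>The graph of \<open>w\<close> is the union of the graphs of all representatives;
    \<open>agree\<close> below justifies the \<open>THE\<close>.\<close>
  define w where "w = (\<lambda>x. if \<exists>u\<in>f. x \<in> dom u then Some (THE y. \<exists>u\<in>f. u x = Some y) else None)"
  have C: "u \<in> cofinite_homeos X" if "u \<in> f" for u
    using carrier_PC_eq_class[OF f that] by simp
  have agree: "y = z" if "u \<in> f" "v \<in> f" "u x = Some y" "v x = Some z" for u v x y z
    using eq_mod_finite_agree[OF X carrier_PC_eq_mod_finite[OF f]] that by blast
  \<comment> \<open>Injectivity of \<open>w\<close> is the agreement property for inverses:
    \<open>x\<close> and \<open>z\<close> are the values at \<open>y\<close> of two equivalent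
    maps.\<close>
  have agree': "x = z" if "u \<in> f" "v \<in> f" "u x = Some y" "v z = Some y" for u v x y z
  proof -
    have "partial_inv u y = Some x" "partial_inv v y = Some z"
      using that C[THEN cofinite_homeosD(1)] by (simp_all add: partial_inv_eq_Some_iff)
    then show ?thesis
      using eq_mod_finite_agree[OF X eq_mod_finite_partial_inv[OF carrier_PC_eq_mod_finite[OF f]]]
        that by blast
  qed
  have w: "w x = Some y \<longleftrightarrow> (\<exists>u\<in>f. u x = Some y)" for x y
  proof -
    have "(THE y. \<exists>u\<in>f. u x = Some y) = y" if "\<exists>u\<in>f. u x = Some y" for y
      using that agree by (intro the_equality) blast+
    then show ?thesis by (auto simp: w_def)
  qed
  have inj: "inj_on w (dom w)"
    by (rule inj_onI) (use agree' in \<open>auto simp: w\<close>)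
  have "partial_continuous X w"
    using w by (rule partial_continuous_Union) (simp add: C cofinite_homeosD)
  \<comment> \<open>The inverse of \<open>w\<close> is itself glued from the inverses of the
    representatives.\<close>
  moreover have "partial_continuous X (partial_inv w)"
  proof (rule partial_continuous_Union)
    show "partial_inv w y = Some x \<longleftrightarrow> (\<exists>v\<in>partial_inv ` f. v y = Some x)" for x y
      using C[THEN cofinite_homeosD(1)]
      by (auto simp: partial_inv_eq_Some_iff[OF inj] w partial_inv_eq_Some_iff)
  qed (auto simp: C cofinite_homeosD)
  ultimately have ph: "partial_homeo X w" using inj by (simp add: partial_homeo_iff)
  obtain u where u: "u \<in> cofinite_homeos X" "f = eq_mod_finite X `` {u}"
    using f by (rule carrier_PC_E)
  then have uf: "u \<in> f" by (metis mem_class)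
  note U = cofinite_homeosD[OF u(1)]
  have ext: "v \<subseteq>\<^sub>m w" if "v \<in> f" for v
    unfolding map_le_def
  proof
    fix x assume "x \<in> dom v"
    then obtain y where "v x = Some y" by auto
    then show "v x = w x" using w that by metis
  qed
  have "dom u \<subseteq> dom w" "ran u \<subseteq> ran w" using uf by (auto simp: w ran_def) blast
  then have wc: "w \<in> cofinite_homeos X"
    using ph finite_subset[OF Diff_mono U(6)] finite_subset[OF Diff_mono U(7)]
    by (simp add: cofinite_homeos_def)
  \<comment> \<open>As \<open>w\<close> extends \<open>u\<close>, the two differ only outside
    \<open>dom u\<close>; hence \<open>w\<close> lies in the class.\<close>
  have "finite {x \<in> topspace X. u x \<noteq> w x}"
    using ext[OF uf] by (intro finite_subset[OF _ U(6)]) (auto simp: map_le_def)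
  then have "w \<in> f" using u wc by (simp add: eq_mod_finite_def)
  then show ?thesis using ext by (auto simp: is_maximal_representative_def)
qed

section \<open>The maximal representative and the partial action\<close>

lemma is_maximal_representative_unique:
  "is_maximal_representative f u \<Longrightarrow> is_maximal_representative f v \<Longrightarrow> u = v"
  by (auto simp: is_maximal_representative_def intro: map_le_antisym)

lemma maximal_representative_eq:
  "is_maximal_representative f u \<Longrightarrow> maximal_representative f = u"
  unfolding maximal_representative_def
  by (blast intro: the_equality is_maximal_representative_unique)

lemma partial_inv_mono:
  assumes "inj_on u (dom u)" "inj_on v (dom v)" "u \<subseteq>\<^sub>m v"
  shows "partial_inv u \<subseteq>\<^sub>m partial_inv v"
  unfolding map_le_def
proof
  fix y assume "y \<in> dom (partial_inv u)"
  then obtain x where x: "partial_inv u y = Some x" by auto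
  then have "u x = Some y" using assms(1) by (simp add: partial_inv_eq_Some_iff)
  then have "v x = Some y" using assms(3) by (metis map_le_def domI)
  then have "partial_inv v y = Some x" using assms(2) by (simp add: partial_inv_eq_Some_iff)
  then show "partial_inv u y = partial_inv v y" using x by simp
qed

text \<open>Inversion exchanges the representatives of \<open>f\<close> and of its group inverse and
  preserves extension, so it carries the greatest element of one class to that of the other.\<close>

lemma is_maximal_representative_partial_inv:
  assumes f: "f \<in> carrier (PC X)" and w: "is_maximal_representative f w"
  shows "is_maximal_representative (inv\<^bsub>PC X\<^esub> f) (partial_inv w)"
  unfolding is_maximal_representative_def
proof (intro conjI ballI)
  have wf: "w \<in> f" and wmax: "\<And>v. v \<in> f \<Longrightarrow> v \<subseteq>\<^sub>m w"
    using w by (auto simp: is_maximal_representative_def)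
  show "partial_inv w \<in> inv\<^bsub>PC X\<^esub> f" using f wf by (rule partial_inv_in_inv_PC)
  fix v assume v: "v \<in> inv\<^bsub>PC X\<^esub> f"
  have f': "inv\<^bsub>PC X\<^esub> f \<in> carrier (PC X)" by (rule group.inv_closed[OF group_PC f])
  have inj: "inj_on v (dom v)" "inj_on w (dom w)"
    using carrier_PC_eq_class[OF f' v] carrier_PC_eq_class[OF f wf]
    by (auto dest: cofinite_homeosD(1))
  have "partial_inv v \<in> f"
    using partial_inv_in_inv_PC[OF f' v] group.inv_inv[OF group_PC f] by simp
  then have "partial_inv (partial_inv v) \<subseteq>\<^sub>m partial_inv w"
    using wmax inj by (intro partial_inv_mono inj_on_partial_inv) auto
  then show "v \<subseteq>\<^sub>m partial_inv w" using inj by (simp add: partial_inv_partial_inv)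
qed

theorem proposition2p1:
  fixes X :: "'a topology"
  assumes "Hausdorff_space X"
    and "\<And>x. x \<in> topspace X \<Longrightarrow> \<not> openin X {x}"
  shows "(\<forall>f\<in>carrier (PC X). \<exists>!u. is_maximal_representative f u) \<and>
         continuous_partial_action (PC X) X maximal_representative"
proof -
  have max: "is_maximal_representative f (maximal_representative f)"
    if "f \<in> carrier (PC X)" for f
    using ex_maximal_representative[OF assms that] maximal_representative_eq by metis
  then have mem: "maximal_representative f \<in> f" if "f \<in> carrier (PC X)" for f
    using that by (simp add: is_maximal_representative_def)
  interpret group "PC X" by (rule group_PC)
  have "continuous_partial_action (PC X) X maximal_representative"
  proof unfold_locales
    fix f assume f: "f \<in> carrier (PC X)"
    show "partial_homeo X (maximal_representative f)"
      using carrier_PC_eq_class[OF f mem[OF f]] by (simp add: cofinite_homeos_def)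
    show "maximal_representative (inv\<^bsub>PC X\<^esub> f) = partial_inv (maximal_representative f)"
      by (intro maximal_representative_eq is_maximal_representative_partial_inv f max)
  next
    let ?m = "maximal_representative \<one>\<^bsub>PC X\<^esub>"
    have "partial_id X \<in> \<one>\<^bsub>PC X\<^esub>"
      unfolding one_PC by (intro mem_class partial_id_in_cofinite_homeos)
    then have le: "partial_id X \<subseteq>\<^sub>m ?m"
      using max[OF one_closed] by (simp add: is_maximal_representative_def)
    \<comment> \<open>\<open>?m\<close> extends the identity, which is already defined on all of
      \<open>topspace X\<close>, so there is no room for a proper extension.\<close>
    have "dom ?m \<subseteq> topspace X"
      using carrier_PC_eq_class[OF one_closed mem[OF one_closed]] by (blast dest: cofinite_homeosD(4))
    then have "?m \<subseteq>\<^sub>m partial_id X"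
      using le by (auto simp: map_le_def dom_partial_id)
    then show "?m = partial_id X" using le by (rule map_le_antisym)
  next
    fix f g assume fg: "f \<in> carrier (PC X)" "g \<in> carrier (PC X)"
    show "maximal_representative f \<circ>\<^sub>m maximal_representative g \<subseteq>\<^sub>m
        maximal_representative (f \<otimes>\<^bsub>PC X\<^esub> g)"
      \<comment> \<open>The composite of the two maximal representatives is one representative of
        the product class, hence extended by the maximal one.\<close>
      using max[OF m_closed[OF fg]] map_comp_in_mult_PC[OF fg mem[OF fg(1)] mem[OF fg(2)]]
      by (simp add: is_maximal_representative_def)
  qed
  then show ?thesis using max is_maximal_representative_unique by blast
qed

end
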